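(* Let $t$ be an integer with $t\geq 2$, and let $F$ be a forest whose size (number of edges) satisfies $m(F)<\frac{1}{18}t^3+\frac{1}{3}t^2+\frac{11}{18}t+1$. Then $f_3(F)\leq t$.
   Context: All graphs are finite, simple, and undirected; $m(G)$ denotes the number of edges of $G$. For an integer $k\geq 2$ and a graph $G$, $f_k(G)$ is the minimum cardinality of a set $X$ of vertices of $G$ such that $G-X$ either has at least $k$ vertices whose degree in $G-X$ equals the maximum degree of $G-X$, or has order less than $k$. *)

theory Defs
  imports Complex_Main "Graph_Theory.Digraph_Component"
begin

text \<open>
  A finite simple undirected graph is an instance of the locale \<open>graph\<close>: a finite, loop-free,
  symmetric digraph without parallel arcs. Each undirected edge is thus a pair of opposite arcs,
  and the degree of a vertex is its \<open>out_degree\<close> (equal to its \<open>in_degree\<close>).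
\<close>

definition num_edges :: "('a, 'b) pre_digraph \<Rightarrow> nat" where
  "num_edges G = card {{tail G e, head G e} | e. e \<in> arcs G}"

text \<open>
  The library predicate \<open>forest\<close> is not usable here: it excludes all directed cycles, and a pair
  of opposite arcs is a directed cycle of length 2. The cycles of the undirected graph are the
  directed cycles of length at least 3.
\<close>

definition undirected_forest :: "('a, 'b) pre_digraph \<Rightarrow> bool" where
  "undirected_forest G \<longleftrightarrow> graph G \<and> \<not> (\<exists>p. pre_digraph.cycle G p \<and> 3 \<le> length p)"

definition delete_verts :: "('a, 'b) pre_digraph \<Rightarrow> 'a set \<Rightarrow> ('a, 'b) pre_digraph" where
  "delete_verts G X = G \<restriction> (verts G - X)"

text \<open>Unspecified if there are no vertices.\<close>

definition max_degree :: "('a, 'b) pre_digraph \<Rightarrow> nat" where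
  "max_degree G = Max (out_degree G ` verts G)"

definition max_degree_verts :: "('a, 'b) pre_digraph \<Rightarrow> 'a set" where
  "max_degree_verts G = {v \<in> verts G. out_degree G v = max_degree G}"

text \<open>
  The number $f_k(G)$. For finite \<open>G\<close> and \<open>k \<ge> 1\<close> the minimum exists, since \<open>X = verts G\<close>
  leaves a graph of order \<open>0 < k\<close>.
\<close>

definition f_num :: "nat \<Rightarrow> ('a, 'b) pre_digraph \<Rightarrow> nat" where
  "f_num k G = (LEAST n. \<exists>X \<subseteq> verts G. card X = n \<and>
     (k \<le> card (max_degree_verts (delete_verts G X)) \<or> card (verts (delete_verts G X)) < k))"

end

theory Submission
  imports Defs
begin

text \<open>
  The structure of a forest enters through the absence of cycles of length 3 and 4: if \<open>x \<noteq> y\<close>,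
  then at most one neighbour of \<open>x\<close> is \<open>y\<close> itself or a neighbour of \<open>y\<close>. Hence, if the three
  largest degrees are \<open>d1 \<ge> d2 \<ge> d3 \<ge> 2\<close>, at least \<open>d1 - 2 \<ge> d1 - d3\<close> neighbours of the first
  vertex can be deleted without any effect on the other two vertices, and likewise for the second
  vertex. Deleting \<open>d1 - d3\<close> and \<open>d2 - d3\<close> of them makes the three degrees equal and maximum
  (\<open>solvable_by_equalizing\<close>).

  Suppose that \<open>t\<close> deletions do not suffice. If \<open>d3 \<ge> 2\<close>, it follows that
  \<open>d1 + d2 \<ge> t + 1 + 2 d3\<close>. After the deletion of a vertex of maximum degree, \<open>t - 1\<close> deletions do
  not suffice, and the two largest degrees \<open>a \<ge> b\<close> that remain satisfy \<open>a \<le> d2\<close> and \<open>b \<le> d3\<close>.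
  Adding \<open>d2 \<ge> a\<close> to the inequality gives \<open>d1 + 2 d2 \<ge> t + 1 + (a + 2 b)\<close>. This is a recursion for
  the combination \<open>d1 + 2 d2\<close>, and it yields \<open>d1 + 2 d2 \<ge> (t + 1)(t + 2) / 2\<close>
  (\<open>unsolvable_degree_bound\<close>). The remaining case \<open>d3 \<le> 1\<close> arises only for \<open>t \<le> 2\<close>: deleting the
  two vertices of largest degree then leaves a matching and isolated vertices, for which one more
  deletion suffices (\<open>solvable_matching\<close>). For these small \<open>t\<close> the bound is checked directly.

  In particular the maximum degree is at least \<open>(t + 1)(t + 2) / 6\<close>. Vertices of maximum degree are
  now deleted one after another while \<open>t\<close> decreases to 0, where at least one edge is still present.
  Adding up the deleted edges shows that there are at least \<open>1 + (\<Sum>s=1..t. (s + 1)(s + 2) / 6)\<close>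
  edges (\<open>unsolvable_edge_bound\<close>), and this sum is the polynomial in the theorem.
\<close>

section \<open>Induced subgraphs of a graph without short cycles\<close>

text \<open>
  The adjacency relation stays fixed and subgraphs are given by their vertex sets, since only
  induced subgraphs occur.
\<close>

locale girth_ge_5 =
  fixes adj :: "'a \<Rightarrow> 'a \<Rightarrow> bool"
  assumes adj_sym: "adj x y \<Longrightarrow> adj y x"
    and adj_irrefl: "\<not> adj x x"
    and no_triangle: "adj x y \<Longrightarrow> adj y z \<Longrightarrow> \<not> adj x z"
    and unique_common_neighbour:
      "x \<noteq> z \<Longrightarrow> adj x y \<Longrightarrow> adj y z \<Longrightarrow> adj x w \<Longrightarrow> adj w z \<Longrightarrow> y = w"
begin

definition nbrs :: "'a set \<Rightarrow> 'a \<Rightarrow> 'a set" where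
  "nbrs V v = {u \<in> V. adj v u}"

definition deg :: "'a set \<Rightarrow> 'a \<Rightarrow> nat" where
  "deg V v = card (nbrs V v)"

definition edge_set :: "'a set \<Rightarrow> 'a set set" where
  "edge_set V = {{u, v} | u v. u \<in> V \<and> v \<in> V \<and> adj u v}"

definition three_max_or_small :: "'a set \<Rightarrow> bool" where
  "three_max_or_small V \<longleftrightarrow>
     card V < 3 \<or> (\<exists>A \<subseteq> V. card A = 3 \<and> (\<forall>a \<in> A. \<forall>v \<in> V. deg V v \<le> deg V a))"

definition solvable :: "'a set \<Rightarrow> nat \<Rightarrow> bool" where
  "solvable V t \<longleftrightarrow> (\<exists>X \<subseteq> V. card X \<le> t \<and> three_max_or_small (V - X))"

lemma finite_nbrs [simp]: "finite V \<Longrightarrow> finite (nbrs V v)"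
  by (simp add: nbrs_def)

lemma nbrs_Diff: "nbrs (V - X) v = nbrs V v - X"
  by (auto simp: nbrs_def)

lemma deg_mono: "finite V \<Longrightarrow> W \<subseteq> V \<Longrightarrow> deg W v \<le> deg V v"
  unfolding deg_def by (rule card_mono) (auto simp: nbrs_def)

lemma deg_pos_iff: "finite V \<Longrightarrow> 0 < deg V v \<longleftrightarrow> (\<exists>u \<in> V. adj v u)"
  by (auto simp: deg_def card_gt_0_iff nbrs_def)

lemma ex_max_deg:
  assumes "finite U" "U \<noteq> {}"
  shows "\<exists>u \<in> U. \<forall>w \<in> U. deg V w \<le> deg V u"
proof -
  have "Max (deg V ` U) \<in> deg V ` U" using assms by (intro Max_in) auto
  then obtain u where u: "u \<in> U" "deg V u = Max (deg V ` U)" by auto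
  then have "\<forall>w \<in> U. deg V w \<le> deg V u" using assms by simp
  with u(1) show ?thesis by blast
qed

lemma three_max_or_small_if_max:
  assumes "finite V" "3 \<le> card {a \<in> V. \<forall>v \<in> V. deg V v \<le> deg V a}"
  shows "three_max_or_small V"
proof -
  obtain A where A: "A \<subseteq> {a \<in> V. \<forall>v \<in> V. deg V v \<le> deg V a}" "card A = 3"
    by (rule obtain_subset_with_card_n[OF assms(2)])
  show ?thesis
    unfolding three_max_or_small_def using A by (intro disjI2 exI[of _ A]) auto
qed

lemma three_max_or_small_if_edgeless:
  assumes "finite V" "\<forall>v \<in> V. deg V v = 0"
  shows "three_max_or_small V"
proof (cases "card V < 3")
  case False
  have "{a \<in> V. \<forall>v \<in> V. deg V v \<le> deg V a} = V" using assms by auto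
  with False assms(1) show ?thesis by (simp add: three_max_or_small_if_max)
qed (simp add: three_max_or_small_def)

lemma solvable_Diff:
  assumes "finite V" "X \<subseteq> V" "solvable (V - X) t"
  shows "solvable V (t + card X)"
proof -
  obtain Y where Y: "Y \<subseteq> V - X" "card Y \<le> t" "three_max_or_small (V - X - Y)"
    using assms(3) unfolding solvable_def by blast
  have "card (X \<union> Y) \<le> t + card X" using card_Un_le[of X Y] Y(2) by linarith
  moreover have "V - X - Y = V - (X \<union> Y)" by blast
  then have "three_max_or_small (V - (X \<union> Y))" using Y(3) by (simp only:)
  moreover have "X \<union> Y \<subseteq> V" using Y(1) assms(2) by blast
  ultimately show ?thesis unfolding solvable_def by blast
qed

lemma solvable_mono: "solvable V s \<Longrightarrow> s \<le> t \<Longrightarrow> solvable V t"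
  unfolding solvable_def by (meson le_trans)

lemma solvable_if_three_max_or_small: "three_max_or_small V \<Longrightarrow> solvable V t"
  unfolding solvable_def by (intro exI[of _ "{}"]) auto

section \<open>Upper bounds on the number of deletions\<close>

text \<open>
  Two distinct elements of the intersection would close a cycle of length 3 or 4 with \<open>v\<close> and \<open>w\<close>.
\<close>

lemma card_shared_nbrs_le_1:
  assumes "finite V" "v \<noteq> w"
  shows "card (nbrs V v \<inter> insert w (nbrs V w)) \<le> 1"
proof -
  have "x = y" if "adj v x" "x = w \<or> adj w x" "adj v y" "y = w \<or> adj w y" for x y
    using that(2,4) that(1,3) assms(2)
      no_triangle[of v x w] no_triangle[of v y w] adj_sym[of w x] adj_sym[of w y]
      unique_common_neighbour[of v w x y]
    by blast
  then show ?thesis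
    using assms(1) by (auto simp: card_le_Suc0_iff_eq nbrs_def)
qed

text \<open>
  If \<open>d \<le> deg V v\<close>, deleting \<open>A\<close> lowers the degree of \<open>v\<close> to \<open>d\<close>, keeps \<open>x\<close> and \<open>y\<close>, and preserves their degrees.
  It exists because \<open>x\<close> and \<open>y\<close> exclude at most one neighbour of \<open>v\<close> each, and \<open>d \<ge> 2\<close>.
\<close>

lemma ex_private_nbrs:
  assumes "finite V" "v \<noteq> x" "v \<noteq> y" "2 \<le> d"
  obtains A where "A \<subseteq> nbrs V v" "card A = deg V v - d"
    "A \<inter> insert x (nbrs V x) = {}" "A \<inter> insert y (nbrs V y) = {}"
proof -
  let ?S = "\<lambda>w. nbrs V v \<inter> insert w (nbrs V w)"
  have "card (?S x \<union> ?S y) \<le> 2"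
    using card_Un_le[of "?S x" "?S y"] card_shared_nbrs_le_1[OF assms(1,2)]
      card_shared_nbrs_le_1[OF assms(1,3)] by linarith
  moreover have "card (nbrs V v) - card (?S x \<union> ?S y) \<le> card (nbrs V v - (?S x \<union> ?S y))"
    using assms(1) by (intro diff_card_le_card_Diff) auto
  ultimately have large: "deg V v - d \<le> card (nbrs V v - (?S x \<union> ?S y))"
    using assms(4) unfolding deg_def by linarith
  obtain A where "A \<subseteq> nbrs V v - (?S x \<union> ?S y)" "card A = deg V v - d"
    by (rule obtain_subset_with_card_n[OF large])
  then show ?thesis by (intro that[of A]) auto
qed

lemma solvable_by_equalizing:
  assumes fin: "finite V" and V: "x \<in> V" "y \<in> V" "z \<in> V"
    and ne: "x \<noteq> y" "x \<noteq> z" "y \<noteq> z"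
    and ord: "deg V z \<le> deg V y" "deg V y \<le> deg V x"
    and rest: "\<forall>v \<in> V - {x, y}. deg V v \<le> deg V z"
    and two: "2 \<le> deg V z"
  shows "solvable V ((deg V x - deg V z) + (deg V y - deg V z))"
proof -
  obtain A where A: "A \<subseteq> nbrs V x" "card A = deg V x - deg V z"
    "A \<inter> insert y (nbrs V y) = {}" "A \<inter> insert z (nbrs V z) = {}"
    using ex_private_nbrs[OF fin ne(1,2) two] by metis
  obtain B where B: "B \<subseteq> nbrs V y" "card B = deg V y - deg V z"
    "B \<inter> insert x (nbrs V x) = {}" "B \<inter> insert z (nbrs V z) = {}"
    using ex_private_nbrs[OF fin ne(1)[symmetric] ne(3) two] by metis
  let ?W = "V - (A \<union> B)"
  have self: "x \<notin> A" "y \<notin> B" using A(1) B(1) adj_irrefl by (auto simp: nbrs_def)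
  have finAB: "finite A" "finite B"
    using A(1) B(1) fin by (meson finite_nbrs finite_subset)+
  have "nbrs ?W x = nbrs V x - A" using B by (auto simp: nbrs_Diff)
  then have dx: "deg ?W x = deg V z"
    using A ord finAB by (simp add: deg_def card_Diff_subset)
  have "nbrs ?W y = nbrs V y - B" using A by (auto simp: nbrs_Diff)
  then have dy: "deg ?W y = deg V z"
    using B ord finAB by (simp add: deg_def card_Diff_subset)
  have "nbrs ?W z = nbrs V z" using A B by (auto simp: nbrs_Diff)
  then have dz: "deg ?W z = deg V z" by (simp add: deg_def)
  have le: "deg ?W v \<le> deg V z" if "v \<in> ?W" for v
  proof (cases "v \<in> {x, y}")
    case False
    then have "deg V v \<le> deg V z" using that rest by auto
    then show ?thesis using deg_mono[of V ?W v] fin by force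
  qed (use dx dy in auto)
  have "{x, y, z} \<subseteq> ?W" using V self A(3,4) B(3,4) by auto
  moreover have "card {x, y, z} = 3" using ne by simp
  ultimately have "three_max_or_small ?W"
    unfolding three_max_or_small_def using le dx dy dz by (intro disjI2 exI[of _ "{x, y, z}"]) auto
  moreover have "A \<union> B \<subseteq> V" using A(1) B(1) by (auto simp: nbrs_def)
  ultimately show ?thesis unfolding solvable_def
    using card_Un_le[of A B] A(2) B(2) by (intro exI[of _ "A \<union> B"]) auto
qed

text \<open>
  In a matching with at least two edges, at least four vertices have the maximum degree 1. If
  there is only one edge, deleting one of its ends leaves all degrees equal to 0.
\<close>

lemma solvable_matching:
  assumes fin: "finite V" and le1: "\<forall>v \<in> V. deg V v \<le> 1"
  shows "solvable V 1"
proof -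
  let ?S = "{a \<in> V. 0 < deg V a}"
  consider "3 \<le> card ?S" | "?S = {}" | s where "card ?S < 3" "s \<in> ?S" by fastforce
  then show ?thesis
  proof cases
    case 1
    have "?S \<subseteq> {a \<in> V. \<forall>v \<in> V. deg V v \<le> deg V a}" using le1 by fastforce
    then have "3 \<le> card {a \<in> V. \<forall>v \<in> V. deg V v \<le> deg V a}"
      using 1 fin card_mono[of "{a \<in> V. \<forall>v \<in> V. deg V v \<le> deg V a}" ?S] by simp
    then show ?thesis
      using fin by (intro solvable_if_three_max_or_small three_max_or_small_if_max)
  next
    case 2
    then show ?thesis
      using fin by (intro solvable_if_three_max_or_small three_max_or_small_if_edgeless) auto
  next
    case (3 s)
    have "deg (V - {s}) u = 0" if u: "u \<in> V - {s}" for u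
    proof (rule ccontr)
      assume "deg (V - {s}) u \<noteq> 0"
      then obtain w where w: "w \<in> V - {s}" "adj u w"
        using deg_pos_iff[of "V - {s}" u] fin by auto
      have "{s, u, w} \<subseteq> ?S"
        using 3(2) u w adj_sym[OF w(2)] deg_pos_iff[OF fin] by auto
      moreover have "u \<noteq> w" using w adj_irrefl by blast
      then have "card {s, u, w} = 3" using u w by auto
      ultimately have "3 \<le> card ?S" using fin card_mono[of ?S "{s, u, w}"] by simp
      with 3(1) show False by simp
    qed
    then have "solvable (V - {s}) 0"
      using fin by (intro solvable_if_three_max_or_small three_max_or_small_if_edgeless) auto
    then show ?thesis using solvable_Diff[of V "{s}" 0] fin 3(2) by simp
  qed
qed

section \<open>Lower bounds for graphs that need many deletions\<close>

text \<open>
  The combination with weights 1 and 2 is the one that can be carried through the induction: from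
  \<open>d1 + d2 \<ge> t + 1 + 2 d3\<close> and \<open>d2 \<ge> a\<close>, where \<open>a \<ge> b\<close> are the two largest degrees after the
  deletion of \<open>v\<close> and \<open>b \<le> d3\<close>, it reproduces itself as \<open>a + 2 b\<close>. Below, \<open>v'\<close> and \<open>w'\<close> are
  vertices of degrees \<open>a\<close> and \<open>b\<close>, and \<open>z\<close> is one of degree \<open>d3\<close>.
\<close>

lemma unsolvable_degree_bound:
  assumes "finite V" "\<not> solvable V t"
    and "v \<in> V" "\<forall>u \<in> V. deg V u \<le> deg V v"
    and "w \<in> V - {v}" "\<forall>u \<in> V - {v}. deg V u \<le> deg V w"
  shows "(t + 1) * (t + 2) \<le> 2 * (deg V v + 2 * deg V w)"
  using assms
proof (induction t arbitrary: V v w)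
  case (0 V v w)
  have "\<not> (\<forall>u \<in> V. deg V u = 0)"
    using 0 three_max_or_small_if_edgeless solvable_if_three_max_or_small by metis
  then have "1 \<le> deg V v" using 0(4) by fastforce
  then show ?case by simp
next
  case (Suc s V v w)
  note fin = Suc.prems(1) and uns = Suc.prems(2) and v = Suc.prems(3,4) and w = Suc.prems(5,6)
  have card3: "3 \<le> card V"
    using uns solvable_if_three_max_or_small unfolding three_max_or_small_def
    by (meson not_le)
  moreover have card2: "card {v, w} = 2" using w by auto
  ultimately have "card (V - {v, w}) \<noteq> 0" using fin v w by (simp add: card_Diff_subset)
  then obtain z where z: "z \<in> V - {v, w}" "\<forall>u \<in> V - {v, w}. deg V u \<le> deg V z"
    using ex_max_deg[of "V - {v, w}" V] fin by (metis card.empty finite_Diff)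
  have zw: "deg V z \<le> deg V w" and wv: "deg V w \<le> deg V v" using v w z by auto
  show ?case
  proof (cases "2 \<le> deg V z")
    case True
    have "solvable V ((deg V v - deg V z) + (deg V w - deg V z))"
      using fin v w z zw wv True by (intro solvable_by_equalizing) auto
    then have gap: "Suc s < (deg V v - deg V z) + (deg V w - deg V z)"
      using uns solvable_mono by (meson not_le)
    let ?V = "V - {v}"
    have uns': "\<not> solvable ?V s" using uns solvable_Diff[of V "{v}" s] fin v by auto
    obtain v' where v': "v' \<in> ?V" "\<forall>u \<in> ?V. deg ?V u \<le> deg ?V v'"
      using ex_max_deg[of ?V ?V] fin w by blast
    have "?V - {v'} \<noteq> {}" using z(1) w(1) by blast
    then obtain w' where w': "w' \<in> ?V - {v'}" "\<forall>u \<in> ?V - {v'}. deg ?V u \<le> deg ?V w'"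
      using ex_max_deg[of "?V - {v'}" ?V] fin by blast
    have IH: "(s + 1) * (s + 2) \<le> 2 * (deg ?V v' + 2 * deg ?V w')"
      using Suc.IH[of ?V v' w'] fin uns' v' w' by blast
    have mono: "deg ?V u \<le> deg V u" for u using fin by (intro deg_mono) auto
    have a: "deg ?V v' \<le> deg V w" using mono[of v'] v' w by (meson le_trans)
    have b: "deg ?V w' \<le> deg V z"
    proof (cases "w' = w")
      case True
      \<comment> \<open>Now \<open>v'\<close> is different from \<open>v\<close> and \<open>w\<close>, so its degree is at most \<open>d3\<close>.\<close>
      then have "deg ?V w' \<le> deg ?V v'" "deg V v' \<le> deg V z" using v' w' z by auto
      then show ?thesis using mono[of v'] by linarith
    next
      case False
      then have "deg V w' \<le> deg V z" using w' z by auto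
      then show ?thesis using mono[of w'] by linarith
    qed
    have "s + 2 + 2 * deg V z \<le> deg V v + deg V w"
      using gap zw wv by linarith
    then have "2 * (s + 2) + 2 * (deg ?V v' + 2 * deg ?V w') \<le> 2 * (deg V v + 2 * deg V w)"
      using a b by simp
    moreover have "(Suc s + 1) * (Suc s + 2) = 2 * (s + 2) + (s + 1) * (s + 2)"
      by (simp add: algebra_simps)
    ultimately show ?thesis using IH by linarith
  next
    case False
    \<comment> \<open>Deleting \<open>v\<close> and \<open>w\<close> leaves maximum degree at most 1, so three deletions suffice.\<close>
    then have le1: "deg (V - {v, w}) u \<le> 1" if "u \<in> V - {v, w}" for u
      using z that deg_mono[of V "V - {v, w}" u] fin by force
    have "solvable (V - {v, w}) 1" using fin le1 by (intro solvable_matching) auto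
    moreover have "1 + card {v, w} = 3" using card2 by simp
    ultimately have "solvable V 3"
      using solvable_Diff[of V "{v, w}" 1] fin v(1) w(1)
      by (metis DiffD1 empty_subsetI insert_subset)
    then have "s \<le> 1" using uns solvable_mono[of V 3 "Suc s"] by force
    then consider "s = 0" | "s = 1" by linarith
    then show ?thesis
    proof cases
      case 1
      have "\<not> (\<forall>u \<in> V. deg V u = 0)"
        using fin uns three_max_or_small_if_edgeless solvable_if_three_max_or_small by metis
      then have "0 < deg V v" using v by fastforce
      then obtain u where u: "u \<in> V" "adj v u" using deg_pos_iff[OF fin] by auto
      then have "0 < deg V u" using deg_pos_iff[OF fin] v adj_sym by blast
      moreover have "u \<noteq> v" using u adj_irrefl by blast
      then have "deg V u \<le> deg V w" using u w by blast
      ultimately have "1 \<le> deg V w" by linarith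
      then show ?thesis using 1 wv by simp
    next
      case 2
      have "2 \<le> deg V w"
      proof (rule ccontr)
        assume "\<not> 2 \<le> deg V w"
        then have "deg (V - {v}) u \<le> 1" if "u \<in> V - {v}" for u
          using w that deg_mono[of V "V - {v}" u] fin by force
        then have "solvable (V - {v}) 1" using fin by (intro solvable_matching) auto
        then have "solvable V 2" using solvable_Diff[of V "{v}" 1] fin v
          by (simp add: numeral_2_eq_2)
        then show False using uns 2 by (simp add: numeral_2_eq_2)
      qed
      then show ?thesis using 2 wv by simp
    qed
  qed
qed

lemma card_edge_set_remove:
  assumes "finite V" "v \<in> V"
  shows "card (edge_set V) = card (edge_set (V - {v})) + deg V v"
proof -
  have fin: "finite (edge_set (V - {v}))"
    by (rule finite_subset[of _ "Pow V"]) (use assms(1) in \<open>auto simp: edge_set_def\<close>)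
  have "edge_set V = edge_set (V - {v}) \<union> (\<lambda>u. {v, u}) ` nbrs V v"
  proof (intro equalityI subsetI)
    fix e assume "e \<in> edge_set V"
    then obtain x y where e: "e = {x, y}" "x \<in> V" "y \<in> V" "adj x y"
      by (auto simp: edge_set_def)
    consider "x = v" | "y = v" | "x \<noteq> v" "y \<noteq> v" by blast
    then show "e \<in> edge_set (V - {v}) \<union> (\<lambda>u. {v, u}) ` nbrs V v"
    proof cases
      case 1
      then show ?thesis using e by (auto simp: nbrs_def)
    next
      case 2
      then have "x \<in> nbrs V v" "e = {v, x}" using e adj_sym by (auto simp: nbrs_def)
      then show ?thesis by blast
    next
      case 3
      then show ?thesis using e unfolding edge_set_def by blast
    qed
  next
    fix e assume "e \<in> edge_set (V - {v}) \<union> (\<lambda>u. {v, u}) ` nbrs V v"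
    then show "e \<in> edge_set V"
      using assms(2) unfolding edge_set_def nbrs_def by blast
  qed
  moreover have "v \<notin> e" if "e \<in> edge_set (V - {v})" for e
    using that unfolding edge_set_def by blast
  then have "edge_set (V - {v}) \<inter> (\<lambda>u. {v, u}) ` nbrs V v = {}" by blast
  moreover have "inj_on (\<lambda>u. {v, u}) (nbrs V v)" by (rule inj_onI) (auto simp: doubleton_eq_iff)
  then have "card ((\<lambda>u. {v, u}) ` nbrs V v) = deg V v" unfolding deg_def by (rule card_image)
  ultimately show ?thesis using fin assms(1) by (simp add: card_Un_disjoint)
qed

text \<open>
  The left-hand side is \<open>18 * (1 + (\<Sum>s=1..t. (s + 1) * (s + 2) / 6))\<close>. The summand is the lower
  bound for the maximum degree that follows from the degree bound for \<open>s\<close> deletions.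
\<close>

lemma unsolvable_edge_bound:
  assumes "finite V" "\<not> solvable V t"
  shows "t ^ 3 + 6 * t ^ 2 + 11 * t + 18 \<le> 18 * card (edge_set V)"
  using assms
proof (induction t arbitrary: V)
  case (0 V)
  then obtain u where u: "u \<in> V" "deg V u \<noteq> 0"
    using three_max_or_small_if_edgeless solvable_if_three_max_or_small by metis
  then have "1 \<le> card (edge_set V)" using card_edge_set_remove[OF 0(1) u(1)] by simp
  then show ?case by simp
next
  case (Suc s V)
  have card3: "3 \<le> card V"
    using Suc.prems solvable_if_three_max_or_small unfolding three_max_or_small_def
    by (meson not_le)
  then have "V \<noteq> {}" by auto
  then obtain v where v: "v \<in> V" "\<forall>u \<in> V. deg V u \<le> deg V v"
    using ex_max_deg Suc.prems(1) by blast
  then have "card (V - {v}) \<noteq> 0" using card3 by simp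
  then have "V - {v} \<noteq> {}" by force
  then obtain w where w: "w \<in> V - {v}" "\<forall>u \<in> V - {v}. deg V u \<le> deg V w"
    using ex_max_deg[of "V - {v}" V] Suc.prems(1) by blast
  have "(Suc s + 1) * (Suc s + 2) \<le> 2 * (deg V v + 2 * deg V w)"
    using unsolvable_degree_bound Suc.prems v w by blast
  also have "\<dots> \<le> 6 * deg V v" using v w by auto
  finally have "3 * ((Suc s + 1) * (Suc s + 2)) \<le> 18 * deg V v" by simp
  moreover have "\<not> solvable (V - {v}) s"
    using Suc.prems solvable_Diff[of V "{v}" s] v by auto
  then have "s ^ 3 + 6 * s ^ 2 + 11 * s + 18 \<le> 18 * card (edge_set (V - {v}))"
    using Suc.IH Suc.prems(1) by simp
  ultimately have "(s ^ 3 + 6 * s ^ 2 + 11 * s + 18) + 3 * ((Suc s + 1) * (Suc s + 2))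
      \<le> 18 * card (edge_set (V - {v})) + 18 * deg V v"
    by (intro add_mono)
  also have "\<dots> = 18 * card (edge_set V)"
    using card_edge_set_remove[OF Suc.prems(1) v(1)] by simp
  finally show ?case by (simp add: algebra_simps power2_eq_square power3_eq_cube)
qed

end

section \<open>Forests\<close>

lemma undirected_forest_girth_ge_5:
  assumes "undirected_forest G"
  shows "girth_ge_5 (\<lambda>u v. u \<rightarrow>\<^bsub>G\<^esub> v)"
proof -
  interpret graph G using assms by (simp add: undirected_forest_def)
  have no_cycle: "\<not> cycle p" if "3 \<le> length p" for p
    using assms that by (auto simp: undirected_forest_def)
  have arcE: "\<exists>e \<in> arcs G. tail G e = u \<and> head G e = v" if "u \<rightarrow>\<^bsub>G\<^esub> v" for u v
    using that by (auto simp: arcs_ends_conv)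
  have sym: "v \<rightarrow>\<^bsub>G\<^esub> u" if "u \<rightarrow>\<^bsub>G\<^esub> v" for u v
    by (rule symD[OF sym_arcs[unfolded symmetric_def] that])
  have irrefl: "\<not> u \<rightarrow>\<^bsub>G\<^esub> u" for u
    using arcE[of u u] no_loops by metis
  have no_C3: "\<not> u \<rightarrow>\<^bsub>G\<^esub> w" if uv: "u \<rightarrow>\<^bsub>G\<^esub> v" and vw: "v \<rightarrow>\<^bsub>G\<^esub> w" for u v w
  proof
    assume "u \<rightarrow>\<^bsub>G\<^esub> w"
    then have wu: "w \<rightarrow>\<^bsub>G\<^esub> u" by (rule sym)
    obtain a b c where "a \<in> arcs G" "tail G a = u" "head G a = v" "b \<in> arcs G" "tail G b = v"
      "head G b = w" "c \<in> arcs G" "tail G c = w" "head G c = u"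
      using arcE[OF uv] arcE[OF vw] arcE[OF wu] by blast
    moreover have "u \<noteq> v" "v \<noteq> w" "w \<noteq> u" using uv vw wu irrefl by auto
    ultimately have "cycle [a, b, c]"
      unfolding cycle_def awalk_def by (intro exI[of _ u]) auto
    then show False using no_cycle[of "[a, b, c]"] by simp
  qed
  have no_C4: "y = w"
    if xz: "x \<noteq> z" and xy: "x \<rightarrow>\<^bsub>G\<^esub> y" and yz: "y \<rightarrow>\<^bsub>G\<^esub> z"
      and xw: "x \<rightarrow>\<^bsub>G\<^esub> w" and wz: "w \<rightarrow>\<^bsub>G\<^esub> z"
    for x y z w
  proof (rule ccontr)
    assume "y \<noteq> w"
    obtain a b c d where "a \<in> arcs G" "tail G a = x" "head G a = y" "b \<in> arcs G" "tail G b = y"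
      "head G b = z" "c \<in> arcs G" "tail G c = z" "head G c = w" "d \<in> arcs G" "tail G d = w"
      "head G d = x"
      using arcE[OF xy] arcE[OF yz] arcE[OF sym[OF wz]] arcE[OF sym[OF xw]] by blast
    moreover have "x \<noteq> y" "y \<noteq> z" "x \<noteq> w" "w \<noteq> z" using xy yz xw wz irrefl by auto
    ultimately have "cycle [a, b, c, d]"
      using xz \<open>y \<noteq> w\<close> unfolding cycle_def awalk_def by (intro exI[of _ x]) auto
    then show False using no_cycle[of "[a, b, c, d]"] by simp
  qed
  show ?thesis
    using sym irrefl no_C3 no_C4 by unfold_locales blast+
qed

lemma (in nomulti_digraph) out_degree_induce_subgraph:
  assumes "v \<in> W"
  shows "out_degree (G \<restriction> W) v = card {u \<in> W. v \<rightarrow>\<^bsub>G\<^esub> u}"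
proof -
  have "bij_betw (head G) (out_arcs (G \<restriction> W) v) {u \<in> W. v \<rightarrow>\<^bsub>G\<^esub> u}"
    unfolding bij_betw_def
  proof
    show "inj_on (head G) (out_arcs (G \<restriction> W) v)"
      using no_multi_arcs by (auto simp: inj_on_def arc_to_ends_def)
    show "head G ` out_arcs (G \<restriction> W) v = {u \<in> W. v \<rightarrow>\<^bsub>G\<^esub> u}"
      using assms by (auto simp: arcs_ends_conv image_iff)
  qed
  then show ?thesis unfolding out_degree_def by (rule bij_betw_same_card)
qed

theorem corollary2p5:
  fixes F :: "('a, 'b) pre_digraph" and t :: nat
  assumes "2 \<le> t"
    and "undirected_forest F"
    and "real (num_edges F) < 1 / 18 * real t ^ 3 + 1 / 3 * real t ^ 2 + 11 / 18 * real t + 1"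
  shows "f_num 3 F \<le> t"
proof -
  interpret graph F using assms(2) by (simp add: undirected_forest_def)
  interpret H: girth_ge_5 "\<lambda>u v. u \<rightarrow>\<^bsub>F\<^esub> v" by (rule undirected_forest_girth_ge_5[OF assms(2)])
  let ?V = "verts F"
  have "{{tail F e, head F e} | e. e \<in> arcs F} = H.edge_set ?V"
  proof (intro equalityI subsetI)
    fix x assume "x \<in> {{tail F e, head F e} | e. e \<in> arcs F}"
    then obtain e where e: "e \<in> arcs F" "x = {tail F e, head F e}" by blast
    then have "tail F e \<in> ?V" "head F e \<in> ?V" "tail F e \<rightarrow>\<^bsub>F\<^esub> head F e"
      by (auto simp: arcs_ends_conv)
    with e show "x \<in> H.edge_set ?V" unfolding H.edge_set_def by blast
  next
    fix x assume "x \<in> H.edge_set ?V"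
    then obtain u v where "x = {u, v}" "u \<rightarrow>\<^bsub>F\<^esub> v" unfolding H.edge_set_def by blast
    then show "x \<in> {{tail F e, head F e} | e. e \<in> arcs F}" by (auto simp: arcs_ends_conv)
  qed
  then have m: "num_edges F = card (H.edge_set ?V)" by (simp add: num_edges_def)
  have "real (18 * num_edges F) < real (t ^ 3 + 6 * t ^ 2 + 11 * t + 18)"
    using assms(3) by simp
  then have "18 * num_edges F < t ^ 3 + 6 * t ^ 2 + 11 * t + 18" by (simp only: of_nat_less_iff)
  then have "H.solvable ?V t" using H.unsolvable_edge_bound[of ?V t] m by force
  then obtain X where X: "X \<subseteq> ?V" "card X \<le> t" "H.three_max_or_small (?V - X)"
    unfolding H.solvable_def by blast
  let ?W = "?V - X" and ?D = "delete_verts F X"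
  have vD: "verts ?D = ?W" by (simp add: delete_verts_def)
  have deg: "out_degree ?D v = H.deg ?W v" if "v \<in> ?W" for v
    using out_degree_induce_subgraph[OF that]
    by (simp add: delete_verts_def H.deg_def H.nbrs_def)
  have "3 \<le> card (max_degree_verts ?D) \<or> card (verts ?D) < 3"
  proof (cases "card ?W < 3")
    case False
    then obtain A where A: "A \<subseteq> ?W" "card A = 3" "\<forall>a \<in> A. \<forall>v \<in> ?W. H.deg ?W v \<le> H.deg ?W a"
      using X(3) unfolding H.three_max_or_small_def by blast
    have "out_degree ?D a = max_degree ?D" if "a \<in> A" for a
      unfolding max_degree_def vD
      by (rule Max_eqI[symmetric]) (use A that deg in auto)
    then have "A \<subseteq> max_degree_verts ?D" using A(1) unfolding max_degree_verts_def vD by blast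
    moreover have "finite (max_degree_verts ?D)" unfolding max_degree_verts_def vD by simp
    ultimately show ?thesis using A(2) card_mono by metis
  qed (simp add: vD)
  then have "f_num 3 F \<le> card X"
    unfolding f_num_def using X(1) by (intro Least_le) blast
  then show ?thesis using X(2) by simp
qed

end
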